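(* Let $X$ be an infinite-dimensional separable $F$-space, and let $\Lambda$ be a countable collection of quasi-rigid continuous linear operators on $X$. Then $$\bigcap_{T\in\Lambda}\mathrm{Rec}(T)$$ is dense-lineable.
   Context: An $F$-space is a completely metrizable topological vector space. For a continuous linear operator $T:X\to X$, a vector $x\in X$ is recurrent for $T$ if there exists a strictly increasing sequence $(\omega_n)_n$ of positive integers with $\lim_nT^{\omega_n}x=x$; $\mathrm{Rec}(T)$ is the set of recurrent vectors. $T$ is quasi-rigid if there exists a strictly increasing sequence $(\theta_n)_n$ of positive integers such that $\{x\in X:\lim_nT^{\theta_n}x=x\}$ is dense in $X$. A subset $A\subset X$ is dense-lineable if $A\cup\{0\}$ contains a dense vector subspace of $X$. *)

theory Defs
  imports "HOL-Analysis.Analysis"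
begin

text \<open>
  The scalars range over the class \<open>real_normed_field\<close>. Its norm is multiplicative, so by the
  Gelfand--Mazur theorem its only instances, up to isometric isomorphism, are the real and the
  complex numbers; both cases are thus covered by one type variable. The vector space operations
  come from the type of the vectors and from an explicit scalar multiplication \<open>smul\<close>.
\<close>

locale topological_vector_space = vector_space smul
  for smul :: "'k::real_normed_field \<Rightarrow> 'a::topological_ab_group_add \<Rightarrow> 'a" +
  assumes continuous_smul: "continuous_on UNIV (\<lambda>(c, x). smul c x)"

locale F_space = topological_vector_space smul
  for smul :: "'k::real_normed_field \<Rightarrow> 'a::topological_ab_group_add \<Rightarrow> 'a" +
  assumes completely_metrizable: "completely_metrizable_space (euclidean :: 'a topology)"

definition infinite_dimensional ::
    "('k::field \<Rightarrow> 'a::ab_group_add \<Rightarrow> 'a) \<Rightarrow> bool" where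
  "infinite_dimensional smul \<longleftrightarrow> \<not> (\<exists>B. finite B \<and> module.span smul B = UNIV)"

definition continuous_linear_operator ::
    "('k::field \<Rightarrow> 'a::{ab_group_add, topological_space} \<Rightarrow> 'a) \<Rightarrow> ('a \<Rightarrow> 'a) \<Rightarrow> bool" where
  "continuous_linear_operator smul T \<longleftrightarrow>
     Vector_Spaces.linear smul smul T \<and> continuous_on UNIV T"

definition Rec :: "('a::topological_space \<Rightarrow> 'a) \<Rightarrow> 'a set" where
  "Rec T = {x. \<exists>\<omega>::nat \<Rightarrow> nat. strict_mono \<omega> \<and> (\<forall>n. 0 < \<omega> n) \<and>
                 (\<lambda>n. (T ^^ \<omega> n) x) \<longlonglongrightarrow> x}"

definition quasi_rigid :: "('a::topological_space \<Rightarrow> 'a) \<Rightarrow> bool" where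
  "quasi_rigid T \<longleftrightarrow>
     (\<exists>\<theta>::nat \<Rightarrow> nat. strict_mono \<theta> \<and> (\<forall>n. 0 < \<theta> n) \<and>
        closure {x. (\<lambda>n. (T ^^ \<theta> n) x) \<longlonglongrightarrow> x} = UNIV)"

definition dense_lineable ::
    "('k::field \<Rightarrow> 'a::{ab_group_add, topological_space} \<Rightarrow> 'a) \<Rightarrow> 'a set \<Rightarrow> bool" where
  "dense_lineable smul A \<longleftrightarrow>
     (\<exists>M. module.subspace smul M \<and> closure M = UNIV \<and> M \<subseteq> A \<union> {0})"

end

theory Submission
  imports Defs
begin

text \<open>
  Recurrence is a \<open>G\<^sub>\<delta>\<close> condition, and if \<open>T\<close> is quasi-rigid along \<open>\<theta>\<close>, then every sequence of
  vectors that are rigid along \<open>\<theta>\<close> is a recurrent point of the coordinatewise action of \<open>T\<close> on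
  \<open>X\<^sup>\<nat>\<close>; such sequences are dense. By Baire's theorem in \<open>X\<^sup>\<nat>\<close> there is a sequence \<open>x\<close> with dense
  range that is recurrent for the coordinatewise action of every \<open>T \<in> \<Lambda>\<close>. Then, for each \<open>T\<close>,
  all \<open>x\<^sub>i\<close> return along one common sequence of exponents, hence so does every vector in
  their span.
\<close>

section \<open>Iterates, product topologies and metrics\<close>

lemma continuous_on_funpow:
  fixes f :: "'a::topological_space \<Rightarrow> 'a"
  assumes "continuous_on UNIV f"
  shows "continuous_on UNIV (f ^^ n)"
proof (induction n)
  case 0
  show ?case by (simp add: id_def)
next
  case (Suc n)
  then show ?case
    using continuous_on_compose2[OF assms Suc] by (simp add: comp_def)
qed

lemma tendsto_fun_iff:
  fixes f :: "'c \<Rightarrow> 'i \<Rightarrow> 'a::topological_space"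
  shows "(f \<longlongrightarrow> l) F \<longleftrightarrow> (\<forall>i. ((\<lambda>c. f c i) \<longlongrightarrow> l i) F)"
  using limitin_componentwise[of "\<lambda>_. euclidean :: 'a topology" "UNIV :: 'i set" f l F]
  by (simp add: euclidean_product_topology)

lemma completely_metrizable_space_seq:
  assumes "completely_metrizable_space (euclidean :: 'a::topological_space topology)"
  shows "completely_metrizable_space (euclidean :: (nat \<Rightarrow> 'a) topology)"
  using assms
    completely_metrizable_space_product_topology[of "\<lambda>_. euclidean :: 'a topology" "UNIV :: nat set"]
  by (simp add: euclidean_product_topology)

lemma closure_Pi_UNIV:
  fixes S :: "'i \<Rightarrow> 'a::topological_space set"
  shows "closure (Pi UNIV S) = Pi UNIV (\<lambda>i. closure (S i))"
  using closure_of_product_topology[of "\<lambda>_. euclidean :: 'a topology" UNIV S]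
  by (simp add: euclidean_product_topology PiE_UNIV_domain)

text \<open>The type class supplies only a topology. The metric found here makes quantitative return
  estimates possible, and its carrier is all of \<open>UNIV\<close> because the carrier is the
  topological space itself.\<close>

lemma metrizable_euclidean_obtain_metric:
  assumes "metrizable_space (euclidean :: 'a::topological_space topology)"
  obtains d :: "'a::topological_space \<Rightarrow> 'a \<Rightarrow> real" where "Metric_space UNIV d"
    and "Metric_space.mtopology UNIV d = euclidean"
proof -
  obtain M and d :: "'a \<Rightarrow> 'a \<Rightarrow> real" where M: "Metric_space M d"
    and top: "euclidean = Metric_space.mtopology M d"
    using assms unfolding metrizable_space_def by blast
  have "M = UNIV"
    using Metric_space.topspace_mtopology[OF M] by (simp flip: top)
  with M top show thesis
    by (intro that[of d]) simp_all
qed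

section \<open>Recurrence as a \<open>G\<^sub>\<delta>\<close> condition and Baire category\<close>

lemma Rec_if_returns:
  fixes T :: "'a::topological_space \<Rightarrow> 'a"
  assumes "Metric_space UNIV d" and "Metric_space.mtopology UNIV d = euclidean"
    and ret: "\<And>m. \<exists>n>m. d ((T ^^ n) x) x < inverse (Suc m)"
  shows "x \<in> Rec T"
proof -
  interpret Metric_space UNIV d by fact
  obtain f where f: "\<And>m. f m > m" "\<And>m. d ((T ^^ f m) x) x < inverse (Suc m)"
    using ret by metis
  \<comment> \<open>Iterating \<open>f\<close> makes each exponent exceed the one before. The orbit
    starts at \<open>f 0\<close> instead of 0, so that already the first exponent is
    positive.\<close>
  define \<omega> where "\<omega> k = (f ^^ Suc k) 0" for k
  have Suc: "\<omega> (Suc k) = f (\<omega> k)" for k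
    by (simp add: \<omega>_def)
  have mono: "strict_mono \<omega>"
    by (simp add: strict_mono_Suc_iff Suc f)
  have "\<omega> 0 > 0"
    using f(1)[of 0] by (simp add: \<omega>_def)
  then have pos: "\<omega> n > 0" for n
    using mono by (metis gr_zeroI not_less_zero strict_mono_less)
  have "d ((T ^^ \<omega> (Suc k)) x) x < inverse (Suc k)" for k
  proof -
    \<comment> \<open>The bound for an exponent comes from its predecessor
      \<open>\<omega> k\<close>, which is at least \<open>k\<close> by strict monotonicity; hence
      the shifted index.\<close>
    have "d ((T ^^ \<omega> (Suc k)) x) x < inverse (Suc (\<omega> k))"
      unfolding Suc by (rule f)
    also have "\<dots> \<le> inverse (Suc k)"
      using mono by (simp add: seq_suble le_imp_inverse_le)
    finally show ?thesis .
  qed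
  then have "(\<lambda>k. d ((T ^^ \<omega> (Suc k)) x) x) \<longlonglongrightarrow> 0"
    by (intro tendsto_sandwich[OF _ _ tendsto_const LIMSEQ_inverse_real_of_nat])
      (auto intro!: always_eventually less_imp_le)
  then have "limitin mtopology (\<lambda>k. (T ^^ \<omega> (Suc k)) x) x sequentially"
    by (simp add: limitin_metric_dist_null)
  then have "(\<lambda>k. (T ^^ \<omega> (Suc k)) x) \<longlonglongrightarrow> x"
    by (simp add: assms(2))
  then have "(\<lambda>k. (T ^^ \<omega> k) x) \<longlonglongrightarrow> x"
    by (rule LIMSEQ_imp_Suc)
  with mono pos show ?thesis
    unfolding Rec_def by blast
qed

lemma returns_if_Rec:
  fixes T :: "'a::topological_space \<Rightarrow> 'a"
  assumes "Metric_space UNIV d" and "Metric_space.mtopology UNIV d = euclidean"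
    and "x \<in> Rec T" and "e > 0"
  shows "\<exists>n>m. d ((T ^^ n) x) x < e"
proof -
  interpret Metric_space UNIV d by fact
  obtain \<omega> where \<omega>: "strict_mono \<omega>" and lim: "(\<lambda>n. (T ^^ \<omega> n) x) \<longlonglongrightarrow> x"
    using assms(3) unfolding Rec_def by blast
  have "limitin mtopology (\<lambda>n. (T ^^ \<omega> n) x) x sequentially"
    using lim by (simp add: assms(2))
  then have "eventually (\<lambda>n. d ((T ^^ \<omega> n) x) x < e) sequentially"
    using \<open>e > 0\<close> by (auto simp: limitin_metric)
  then obtain k where k: "d ((T ^^ \<omega> n) x) x < e" if "n \<ge> k" for n
    by (auto simp: eventually_sequentially)
  \<comment> \<open>Index \<open>k\<close> ensures closeness to \<open>x\<close>; index
    \<open>Suc m\<close> ensures that the exponent is beyond \<open>m\<close>, since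
    \<open>\<omega> j \<ge> j\<close>.\<close>
  have "\<omega> (max k (Suc m)) > m"
    using seq_suble[OF \<omega>, of "max k (Suc m)"] by simp
  then show ?thesis
    using k[of "max k (Suc m)"] by auto
qed

text \<open>Recurrence amounts to returning, for each \<open>m\<close>, within
  \<open>inverse (Suc m)\<close> at some time beyond \<open>m\<close>. Each of these conditions is a
  union of open ones, as the iterates of \<open>T\<close> are continuous.\<close>

lemma Rec_eq_Inter_open:
  fixes T :: "'a::topological_space \<Rightarrow> 'a"
  assumes "metrizable_space (euclidean :: 'a topology)" and "continuous_on UNIV T"
  obtains G :: "nat \<Rightarrow> 'a set" where "\<And>m. open (G m)" "Rec T = (\<Inter>m. G m)"
proof -
  obtain d :: "'a \<Rightarrow> 'a \<Rightarrow> real" where "Metric_space UNIV d"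
    and top: "Metric_space.mtopology UNIV d = euclidean"
    using metrizable_euclidean_obtain_metric[OF assms(1)] .
  interpret Metric_space UNIV d by fact
  define G where "G m = (\<Union>n\<in>{m<..}. {x. d ((T ^^ n) x) x < inverse (Suc m)})" for m
  show ?thesis
  proof
    fix m
    have "open {x. d ((T ^^ n) x) x < inverse (Suc m)}" for n
    proof -
      have "continuous_map euclidean euclidean (\<lambda>x. d ((T ^^ n) x) x)"
        using continuous_on_funpow[OF assms(2), of n]
          continuous_map_mdist[of euclidean Self "T ^^ n" "\<lambda>x. x"]
        by (simp add: mtopology_of_def top)
      then show ?thesis
        by (simp add: open_Collect_less)
    qed
    then show "open (G m)"
      unfolding G_def by blast
  next
    have "x \<in> Rec T \<longleftrightarrow> (\<forall>m. \<exists>n>m. d ((T ^^ n) x) x < inverse (Suc m))" for x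
    proof (intro iffI allI)
      show "\<exists>n>m. d ((T ^^ n) x) x < inverse (Suc m)" if "x \<in> Rec T" for m
        by (rule returns_if_Rec[OF \<open>Metric_space UNIV d\<close> top that]) simp
      show "x \<in> Rec T" if "\<forall>m. \<exists>n>m. d ((T ^^ n) x) x < inverse (Suc m)"
        by (rule Rec_if_returns[OF \<open>Metric_space UNIV d\<close> top that[rule_format]])
    qed
    then show "Rec T = (\<Inter>m. G m)"
      unfolding G_def by (auto simp: Bex_def)
  qed
qed

text \<open>Baire's theorem for countably many dense \<open>G\<^sub>\<delta>\<close> sets. The space
  is arbitrary because the lemma is applied to sequences of vectors, where the extra family
  \<open>\<H>\<close> forces the range to be dense.\<close>

lemma Inter_Rec_Inter_open_nonempty:
  fixes \<Lambda> :: "('a::topological_space \<Rightarrow> 'a) set"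
  assumes cm: "completely_metrizable_space (euclidean :: 'a topology)"
    and "countable \<Lambda>"
    and cont: "\<And>T. T \<in> \<Lambda> \<Longrightarrow> continuous_on UNIV T"
    and dense: "\<And>T. T \<in> \<Lambda> \<Longrightarrow> closure (Rec T) = UNIV"
    and "countable \<H>"
    and \<H>: "\<And>H. H \<in> \<H> \<Longrightarrow> open H \<and> closure H = UNIV"
  shows "(\<Inter>T\<in>\<Lambda>. Rec T) \<inter> \<Inter>\<H> \<noteq> {}"
proof -
  have "\<exists>G :: nat \<Rightarrow> 'a set. (\<forall>m. open (G m)) \<and> Rec T = (\<Inter>m. G m)" if "T \<in> \<Lambda>" for T
    using Rec_eq_Inter_open[OF completely_metrizable_imp_metrizable_space[OF cm] cont[OF that]]
    by metis
  then obtain G :: "('a \<Rightarrow> 'a) \<Rightarrow> nat \<Rightarrow> 'a set"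
    where G: "\<And>T m. T \<in> \<Lambda> \<Longrightarrow> open (G T m)" "\<And>T. T \<in> \<Lambda> \<Longrightarrow> Rec T = (\<Inter>m. G T m)"
    by metis
  define \<G> where "\<G> = (\<Union>T\<in>\<Lambda>. range (G T)) \<union> \<H>"
  have "countable \<G>"
    unfolding \<G>_def using assms by auto
  moreover have "open H \<and> closure H = UNIV" if H: "H \<in> \<G>" for H
  proof (cases "H \<in> \<H>")
    case False
    then obtain T m where T: "T \<in> \<Lambda>" "H = G T m"
      using H unfolding \<G>_def by blast
    \<comment> \<open>Each open set in the representation of \<open>Rec T\<close> contains
      \<open>Rec T\<close> and so inherits its density.\<close>
    have "closure (Rec T) \<subseteq> closure H"
      using G(2)[OF T(1)] T(2) by (intro closure_mono) auto
    then show ?thesis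
      using T G dense by auto
  qed (use \<H> in blast)
  ultimately have "closure (\<Inter>\<G>) = UNIV"
    using Baire_category[of "euclidean :: 'a topology" \<G>] cm by simp
  then have "\<Inter>\<G> \<noteq> {}"
    by (metis UNIV_not_empty closure_empty)
  moreover have "\<Inter>\<G> \<subseteq> (\<Inter>T\<in>\<Lambda>. Rec T) \<inter> \<Inter>\<H>"
    unfolding \<G>_def using G(2) by blast
  ultimately show ?thesis
    by blast
qed

section \<open>Sequences of vectors: coordinatewise recurrence and dense range\<close>

lemma funpow_coordinatewise:
  fixes T :: "'a \<Rightarrow> 'a"
  shows "((\<lambda>x i. T (x i)) ^^ n) x = (\<lambda>i. (T ^^ n) (x i))"
  by (induction n) auto

text \<open>This is where quasi-rigidity enters: one \<open>\<theta>\<close> serves all coordinates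
  at once, whereas recurrence of the single coordinates could need different exponents for each. A
  product of dense sets is dense.\<close>

lemma closure_Rec_coordinatewise:
  fixes T :: "'a::topological_space \<Rightarrow> 'a"
  assumes "quasi_rigid T"
  shows "closure (Rec (\<lambda>(x :: 'i \<Rightarrow> 'a) i. T (x i))) = UNIV"
proof -
  obtain \<theta> :: "nat \<Rightarrow> nat" where \<theta>: "strict_mono \<theta>" "\<forall>n. 0 < \<theta> n"
    and dense: "closure {x. (\<lambda>n. (T ^^ \<theta> n) x) \<longlonglongrightarrow> x} = UNIV"
    using assms unfolding quasi_rigid_def by blast
  have "Pi UNIV (\<lambda>_::'i. {x. (\<lambda>n. (T ^^ \<theta> n) x) \<longlonglongrightarrow> x}) \<subseteq> Rec (\<lambda>x i. T (x i))"
    using \<theta> unfolding Rec_def by (auto simp: funpow_coordinatewise tendsto_fun_iff)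
  then have "closure (Pi UNIV (\<lambda>_::'i. {x. (\<lambda>n. (T ^^ \<theta> n) x) \<longlonglongrightarrow> x}))
      \<subseteq> closure (Rec (\<lambda>x i. T (x i)))"
    by (rule closure_mono)
  then show ?thesis
    by (auto simp: closure_Pi_UNIV dense)
qed

lemma open_dense_hitting_sequences:
  fixes V :: "'a::topological_space set"
  assumes "open V" and "V \<noteq> {}"
  shows "open {x :: nat \<Rightarrow> 'a. \<exists>n. x n \<in> V}" and "closure {x :: nat \<Rightarrow> 'a. \<exists>n. x n \<in> V} = UNIV"
proof -
  have "open ((\<lambda>x :: nat \<Rightarrow> 'a. x n) -` V)" for n
    by (rule open_vimage[OF assms(1) continuous_on_product_coordinates])
  moreover have "{x :: nat \<Rightarrow> 'a. \<exists>n. x n \<in> V} = (\<Union>n. (\<lambda>x. x n) -` V)"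
    by auto
  ultimately show "open {x :: nat \<Rightarrow> 'a. \<exists>n. x n \<in> V}"
    by (metis open_UN)
  obtain v where "v \<in> V"
    using assms(2) by blast
  define H where "H = {x :: nat \<Rightarrow> 'a. \<exists>n. x n \<in> V}"
  have "z \<in> closure H" for z
  proof (rule ccontr)
    assume "z \<notin> closure H"
    then have z: "open (- closure H)" "z \<in> - closure H"
      by auto
    \<comment> \<open>Changing \<open>z\<close> in the single coordinate \<open>k\<close> is
      invisible to coordinate \<open>i\<close> once \<open>k > i\<close>. So these modifications
      tend to \<open>z\<close> in the product topology, while each of them meets
      \<open>V\<close>.\<close>
    have "(\<lambda>k. (z(k := v)) i) \<longlonglongrightarrow> z i" for i
      by (rule tendsto_eventually, rule eventually_sequentiallyI[of "Suc i"]) auto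
    then have "(\<lambda>k. z(k := v)) \<longlonglongrightarrow> z"
      unfolding tendsto_fun_iff by blast
    from topological_tendstoD[OF this z]
    obtain k where "z(k := v) \<in> - closure H"
      using eventually_happens' sequentially_bot by blast
    moreover have "z(k := v) \<in> H"
      unfolding H_def using \<open>v \<in> V\<close> by (intro CollectI exI[of _ k]) simp
    ultimately show False
      using closure_subset[of H] by blast
  qed
  then show "closure {x :: nat \<Rightarrow> 'a. \<exists>n. x n \<in> V} = UNIV"
    unfolding H_def[symmetric] by blast
qed

text \<open>Balls of radius \<open>inverse (Suc k)\<close> about a countable dense set turn density
  into countably many conditions, the form in which Baire's theorem can impose it on the range of a
  sequence.\<close>

lemma separable_metrizable_countable_dense_test:
  assumes "metrizable_space (euclidean :: 'a::topological_space topology)"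
    and "separable_space (euclidean :: 'a topology)"
  obtains \<V> :: "'a::topological_space set set" where "countable \<V>" "\<And>V. V \<in> \<V> \<Longrightarrow> open V \<and> V \<noteq> {}"
    "\<And>A. (\<And>V. V \<in> \<V> \<Longrightarrow> A \<inter> V \<noteq> {}) \<Longrightarrow> closure A = UNIV"
proof -
  obtain d :: "'a \<Rightarrow> 'a \<Rightarrow> real" where "Metric_space UNIV d"
    and top: "Metric_space.mtopology UNIV d = euclidean"
    using metrizable_euclidean_obtain_metric[OF assms(1)] .
  interpret Metric_space UNIV d by fact
  obtain D :: "'a set" where D: "countable D" "closure D = UNIV"
    using assms(2) unfolding separable_space_def by auto
  define \<V> where "\<V> = (\<lambda>(q, k). mball q (inverse (Suc k))) ` (D \<times> (UNIV :: nat set))"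
  show ?thesis
  proof
    show "countable \<V>"
      unfolding \<V>_def using D(1) by auto
    show "open V \<and> V \<noteq> {}" if "V \<in> \<V>" for V
    proof -
      obtain q k where V: "V = mball q (inverse (Suc k))"
        using \<open>V \<in> \<V>\<close> unfolding \<V>_def by auto
      have "openin mtopology V" "q \<in> V"
        unfolding V by auto
      then show ?thesis
        by (auto simp: top)
    qed
    show "closure A = UNIV" if A: "\<And>V. V \<in> \<V> \<Longrightarrow> A \<inter> V \<noteq> {}" for A
    proof -
      have "q \<in> closure A" if "q \<in> D" for q
      proof (rule ccontr)
        assume "q \<notin> closure A"
        then have "openin mtopology (- closure A)" "q \<in> - closure A"
          by (auto simp: top)
        then obtain r where r: "r > 0" "mball q r \<subseteq> - closure A"
          unfolding openin_mtopology by blast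
        obtain k where "inverse (Suc k) < r"
          using reals_Archimedean[OF r(1)] by auto
        then have "mball q (inverse (Suc k)) \<subseteq> - closure A"
          using r(2) mball_subset_concentric[of "inverse (Suc k)" r q] by fastforce
        moreover have "mball q (inverse (Suc k)) \<in> \<V>"
          using \<open>q \<in> D\<close> unfolding \<V>_def by auto
        ultimately show False
          using A closure_subset by blast
      qed
      then have "closure D \<subseteq> closure A"
        by (simp add: closure_minimal subsetI)
      then show ?thesis
        using D(2) by auto
    qed
  qed
qed

section \<open>Passing to linear spans\<close>

lemma (in topological_vector_space) tendsto_smul:
  assumes "(f \<longlongrightarrow> l) F"
  shows "((\<lambda>n. smul c (f n)) \<longlongrightarrow> smul c l) F"
proof -
  have "((\<lambda>n. case (c, f n) of (c, x) \<Rightarrow> smul c x) \<longlongrightarrow> (case (c, l) of (c, x) \<Rightarrow> smul c x)) F"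
    using assms
    by (intro continuous_on_tendsto_compose[OF continuous_smul] tendsto_Pair tendsto_const) auto
  then show ?thesis
    by simp
qed

text \<open>Because \<open>\<omega>\<close> is fixed, limits can be added and scaled.
  \<open>Rec T\<close> itself lets the exponents depend on the vector, so this argument does not
  apply to it.\<close>

lemma (in topological_vector_space) subspace_returns:
  assumes "Vector_Spaces.linear smul smul T"
  shows "subspace {y. (\<lambda>n. (T ^^ \<omega> n) y) \<longlonglongrightarrow> y}"
proof -
  interpret T: Vector_Spaces.linear smul smul T by fact
  have "(T ^^ n) 0 = 0" "(T ^^ n) (x + y) = (T ^^ n) x + (T ^^ n) y"
    "(T ^^ n) (smul c x) = smul c ((T ^^ n) x)" for n x y c
    by (induction n) (auto simp: T.zero T.add T.scale)
  then show ?thesis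
    unfolding subspace_def by (auto intro: tendsto_add tendsto_smul)
qed

text \<open>Recurrence of the whole sequence \<open>x\<close> yields one \<open>\<omega>\<close> for
  all its terms, and the vectors returning along this \<open>\<omega>\<close> form a
  subspace.\<close>

lemma (in topological_vector_space) span_range_subset_Rec:
  assumes "Vector_Spaces.linear smul smul T" and "x \<in> Rec (\<lambda>x i. T (x i))"
  shows "span (range x) \<subseteq> Rec T"
proof -
  obtain \<omega> :: "nat \<Rightarrow> nat" where \<omega>: "strict_mono \<omega>" "\<forall>n. 0 < \<omega> n"
    and lim: "\<And>i. (\<lambda>n. (T ^^ \<omega> n) (x i)) \<longlonglongrightarrow> x i"
    using assms(2) unfolding Rec_def by (auto simp: funpow_coordinatewise tendsto_fun_iff)
  have "span (range x) \<subseteq> {y. (\<lambda>n. (T ^^ \<omega> n) y) \<longlonglongrightarrow> y}"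
    using lim by (intro span_minimal subspace_returns[OF assms(1)]) auto
  also have "\<dots> \<subseteq> Rec T"
    using \<omega> unfolding Rec_def by blast
  finally show ?thesis .
qed

theorem corollary4p6:
  fixes smul :: "'k::real_normed_field \<Rightarrow> 'a::topological_ab_group_add \<Rightarrow> 'a"
    and \<Lambda> :: "('a \<Rightarrow> 'a) set"
  assumes "F_space smul"
    and "infinite_dimensional smul"
    and "separable_space (euclidean :: 'a topology)"
    and "countable \<Lambda>"
    and "\<And>T. T \<in> \<Lambda> \<Longrightarrow> continuous_linear_operator smul T"
    and "\<And>T. T \<in> \<Lambda> \<Longrightarrow> quasi_rigid T"
  shows "dense_lineable smul (\<Inter>T\<in>\<Lambda>. Rec T)"
proof -
  interpret F_space smul by fact
  define lift :: "('a \<Rightarrow> 'a) \<Rightarrow> (nat \<Rightarrow> 'a) \<Rightarrow> nat \<Rightarrow> 'a" where "lift T = (\<lambda>x i. T (x i))" for T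
  obtain \<V> :: "'a set set" where \<V>: "countable \<V>" "\<And>V. V \<in> \<V> \<Longrightarrow> open V \<and> V \<noteq> {}"
    and test: "\<And>A. (\<And>V. V \<in> \<V> \<Longrightarrow> A \<inter> V \<noteq> {}) \<Longrightarrow> closure A = UNIV"
    using separable_metrizable_countable_dense_test
      [OF completely_metrizable_imp_metrizable_space[OF completely_metrizable] assms(3)] by blast
  \<comment> \<open>A point of this intersection is a sequence recurrent under every lifted operator
    and with a term in every test set \<open>V\<close>.\<close>
  have "(\<Inter>S\<in>lift ` \<Lambda>. Rec S) \<inter> \<Inter>((\<lambda>V. {x. \<exists>n. x n \<in> V}) ` \<V>) \<noteq> {}"
  proof (rule Inter_Rec_Inter_open_nonempty)
    show "completely_metrizable_space (euclidean :: (nat \<Rightarrow> 'a) topology)"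
      by (rule completely_metrizable_space_seq[OF completely_metrizable])
    show "continuous_on UNIV S" if S: "S \<in> lift ` \<Lambda>" for S
    proof -
      obtain T where "T \<in> \<Lambda>" "S = lift T"
        using S by blast
      moreover from this have "continuous_on UNIV T"
        using assms(5) unfolding continuous_linear_operator_def by blast
      ultimately show ?thesis
        unfolding lift_def
        by (auto intro!: continuous_on_coordinatewise_then_product
            continuous_on_compose2[of UNIV T])
    qed
    show "closure (Rec S) = UNIV" if "S \<in> lift ` \<Lambda>" for S
      using that assms(6) closure_Rec_coordinatewise unfolding lift_def by blast
    show "open H \<and> closure H = UNIV" if H: "H \<in> (\<lambda>V. {x :: nat \<Rightarrow> 'a. \<exists>n. x n \<in> V}) ` \<V>" for H
    proof -
      obtain V where "V \<in> \<V>" and H: "H = {x. \<exists>n. x n \<in> V}"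
        using H by (rule imageE)
      then show ?thesis
        using \<V>(2)[of V] open_dense_hitting_sequences[of V] by simp
    qed
    show "countable (lift ` \<Lambda>)" "countable ((\<lambda>V. {x :: nat \<Rightarrow> 'a. \<exists>n. x n \<in> V}) ` \<V>)"
      using assms(4) \<V>(1) by (simp_all only: countable_image)
  qed
  then obtain x where rec: "\<And>T. T \<in> \<Lambda> \<Longrightarrow> x \<in> Rec (lift T)"
    and hit: "\<And>V. V \<in> \<V> \<Longrightarrow> \<exists>n. x n \<in> V"
    by auto
  have "closure (range x) = UNIV"
    using hit by (intro test) blast
  then have "closure (span (range x)) = UNIV"
    using closure_mono[OF span_superset[of "range x"]] by auto
  moreover have "span (range x) \<subseteq> (\<Inter>T\<in>\<Lambda>. Rec T)"
    using rec span_range_subset_Rec assms(5)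
    unfolding continuous_linear_operator_def lift_def by blast
  ultimately show ?thesis
    unfolding dense_lineable_def using subspace_span by blast
qed

end
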